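(* Let $\mathcal{P}$ be a finite classical polar space, or one class of generators of $\mathcal{Q}^{+}(2d-1,q)$ with $d$ even, and let $\mathcal{L}$ be a Cameron-Liebler set of $\mathcal{P}$ with parameter $x$. Then $x$ is a non-negative integer.
   Context: A finite classical polar space of rank $d$ is the geometry of totally isotropic subspaces (viewed projectively) of a non-degenerate quadratic or reflexive sesquilinear form; types and parameters $e$: $\mathcal{Q}^{+}(2d-1,q)$ ($e=0$), $\mathcal{H}(2d-1,q)$, $q$ a square ($e=1/2$), $\mathcal{W}(2d-1,q)$ ($e=1$), $\mathcal{Q}(2d,q)$ ($e=1$), $\mathcal{H}(2d,q)$, $q$ a square ($e=3/2$), $\mathcal{Q}^{-}(2d+1,q)$ ($e=2$). Generators are subspaces of projective dimension $d-1$; disjoint means trivial intersection. For a polar space, a set $\mathcal{L}$ of generators is a Cameron-Liebler set with parameter $x=|\mathcal{L}|/\prod_{i=0}^{d-2}(q^{e+i}+1)$ if every generator $\pi$ is disjoint from exactly $(x-\chi_\pi)q^{\binom{d-1}{2}+e(d-1)}$ elements of $\mathcal{L}$, where $\chi_\pi=1$ if $\pi\in\mathcal{L}$ and $0$ otherwise. The generators of $\mathcal{Q}^{+}(2d-1,q)$ split into two classes (same class iff the intersection has projective dimension $\equiv d-1\pmod 2$); for a class $\mathcal{G}$ with $d$ even, $\mathcal{L}\subseteq\mathcal{G}$ is a Cameron-Liebler set with parameter $x=|\mathcal{L}|/\prod_{i=1}^{d-2}(q^i+1)$ if every $\pi\in\mathcal{G}$ is disjoint from exactly $(x-\chi_\pi)q^{\binom{d-1}{2}}$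 elements of $\mathcal{L}$. *)

theory Defs
  imports "HOL-Analysis.Analysis" "HOL-Number_Theory.Cong"
begin

section \<open>Forms on the vector space of column vectors over a finite field\<close>

text \<open>Convention: linear in the first argument, \<open>\<sigma>\<close>-semilinear in the second.\<close>

definition sesquilinear :: "('k::field \<Rightarrow> 'k) \<Rightarrow> ('k ^ 'n \<Rightarrow> 'k ^ 'n \<Rightarrow> 'k) \<Rightarrow> bool" where
  "sesquilinear \<sigma> f \<longleftrightarrow>
     (\<forall>v. Vector_Spaces.linear (*s) (*) (\<lambda>u. f u v)) \<and>
     (\<forall>u v w. f u (v + w) = f u v + f u w) \<and>
     (\<forall>c u v. f u (c *s v) = \<sigma> c * f u v)"

definition nondegenerate :: "('k::field ^ 'n \<Rightarrow> 'k ^ 'n \<Rightarrow> 'k) \<Rightarrow> bool" where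
  "nondegenerate f \<longleftrightarrow> (\<forall>u. (\<forall>v. f u v = 0) \<longrightarrow> u = 0)"

definition alternating_form :: "('k::field ^ 'n \<Rightarrow> 'k ^ 'n \<Rightarrow> 'k) \<Rightarrow> bool" where
  "alternating_form f \<longleftrightarrow> sesquilinear id f \<and> (\<forall>v. f v v = 0)"

definition involutory_automorphism :: "('k::field \<Rightarrow> 'k) \<Rightarrow> bool" where
  "involutory_automorphism \<sigma> \<longleftrightarrow>
     (\<forall>a b. \<sigma> (a + b) = \<sigma> a + \<sigma> b) \<and> (\<forall>a b. \<sigma> (a * b) = \<sigma> a * \<sigma> b) \<and>
     \<sigma> \<circ> \<sigma> = id \<and> \<sigma> \<noteq> id"

text \<open>A finite field has an involutory automorphism only if its order is a square, so the
  condition that \<open>q\<close> be a square need not be imposed on Hermitian polar spaces separately.\<close>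

definition hermitian_form :: "('k::field ^ 'n \<Rightarrow> 'k ^ 'n \<Rightarrow> 'k) \<Rightarrow> bool" where
  "hermitian_form f \<longleftrightarrow>
     (\<exists>\<sigma>. involutory_automorphism \<sigma> \<and> sesquilinear \<sigma> f \<and> (\<forall>u v. f v u = \<sigma> (f u v)))"

definition polar_form :: "('k::field ^ 'n \<Rightarrow> 'k) \<Rightarrow> 'k ^ 'n \<Rightarrow> 'k ^ 'n \<Rightarrow> 'k" where
  "polar_form Q u v = Q (u + v) - Q u - Q v"

definition quadratic_form :: "('k::field ^ 'n \<Rightarrow> 'k) \<Rightarrow> bool" where
  "quadratic_form Q \<longleftrightarrow> (\<forall>c v. Q (c *s v) = c\<^sup>2 * Q v) \<and> sesquilinear id (polar_form Q)"

text \<open>Non-degeneracy (non-singularity) of a quadratic form does not ask the polar form to be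
  non-degenerate: in characteristic 2 and odd dimension the latter never happens.\<close>

definition nondegenerate_quadratic :: "('k::field ^ 'n \<Rightarrow> 'k) \<Rightarrow> bool" where
  "nondegenerate_quadratic Q \<longleftrightarrow> (\<forall>u. Q u = 0 \<and> (\<forall>v. polar_form Q u v = 0) \<longrightarrow> u = 0)"

section \<open>Finite classical polar spaces\<close>

text \<open>A polar space is given by its set of totally isotropic (totally singular, for quadratic
  forms) vector subspaces, the zero subspace included.\<close>

definition singular_subspaces :: "('k::field ^ 'n \<Rightarrow> 'k) \<Rightarrow> ('k ^ 'n) set set" where
  "singular_subspaces Q = {U. vec.subspace U \<and> (\<forall>u\<in>U. Q u = 0)}"

definition isotropic_subspaces :: "('k::field ^ 'n \<Rightarrow> 'k ^ 'n \<Rightarrow> 'k) \<Rightarrow> ('k ^ 'n) set set" where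
  "isotropic_subspaces f = {U. vec.subspace U \<and> (\<forall>u\<in>U. \<forall>v\<in>U. f u v = 0)}"

definition quadric :: "('k::{field,finite} ^ 'n) set set \<Rightarrow> bool" where
  "quadric S \<longleftrightarrow>
     (\<exists>Q. quadratic_form Q \<and> nondegenerate_quadratic Q \<and> S = singular_subspaces Q)"

definition hermitian_variety :: "('k::{field,finite} ^ 'n) set set \<Rightarrow> bool" where
  "hermitian_variety S \<longleftrightarrow>
     (\<exists>f. hermitian_form f \<and> nondegenerate f \<and> S = isotropic_subspaces f)"

definition symplectic_space :: "('k::{field,finite} ^ 'n) set set \<Rightarrow> bool" where
  "symplectic_space S \<longleftrightarrow>
     (\<exists>f. alternating_form f \<and> nondegenerate f \<and> S = isotropic_subspaces f)"

definition proj_dim :: "('k::field ^ 'n) set \<Rightarrow> int" where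
  "proj_dim U = int (vec.dim U) - 1"

definition polar_rank :: "('k::{field,finite} ^ 'n) set set \<Rightarrow> nat" where
  "polar_rank S = Max (vec.dim ` S)"

text \<open>In the order of the constructors:
  \<open>Q\<^sup>+(2d-1,q)\<close>, \<open>H(2d-1,q)\<close>, \<open>W(2d-1,q)\<close>, \<open>Q(2d,q)\<close>, \<open>H(2d,q)\<close>, \<open>Q\<^sup>-(2d+1,q)\<close>.\<close>

datatype polar_type =
  Hyperbolic | Hermitian_Odd | Symplectic | Parabolic | Hermitian_Even | Elliptic

fun type_parameter :: "polar_type \<Rightarrow> real" where
  "type_parameter Hyperbolic = 0"
| "type_parameter Hermitian_Odd = 1/2"
| "type_parameter Symplectic = 1"
| "type_parameter Parabolic = 1"
| "type_parameter Hermitian_Even = 3/2"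
| "type_parameter Elliptic = 2"

text \<open>The ambient projective space has dimension \<open>CARD('n) - 1\<close>. For quadrics in even vector
  space dimension the rank is what separates the hyperbolic from the elliptic ones; for the other
  types it is determined by the ambient dimension.\<close>

definition classical_polar_space ::
    "polar_type \<Rightarrow> nat \<Rightarrow> ('k::{field,finite} ^ 'n) set set \<Rightarrow> bool" where
  "classical_polar_space T d S \<longleftrightarrow> d \<ge> 1 \<and> polar_rank S = d \<and>
     (case T of
        Hyperbolic \<Rightarrow> quadric S \<and> CARD('n) = 2 * d
      | Hermitian_Odd \<Rightarrow> hermitian_variety S \<and> CARD('n) = 2 * d
      | Symplectic \<Rightarrow> symplectic_space S \<and> CARD('n) = 2 * d
      | Parabolic \<Rightarrow> quadric S \<and> CARD('n) = 2 * d + 1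
      | Hermitian_Even \<Rightarrow> hermitian_variety S \<and> CARD('n) = 2 * d + 1
      | Elliptic \<Rightarrow> quadric S \<and> CARD('n) = 2 * d + 2)"

definition generators :: "nat \<Rightarrow> ('k::{field,finite} ^ 'n) set set \<Rightarrow> ('k ^ 'n) set set" where
  "generators d S = {U \<in> S. proj_dim U = int d - 1}"

section \<open>Cameron-Liebler sets of generators\<close>

definition disjoint_members ::
    "('k::{field,finite} ^ 'n) set set \<Rightarrow> ('k ^ 'n) set \<Rightarrow> ('k ^ 'n) set set" where
  "disjoint_members L \<pi> = {\<tau> \<in> L. \<pi> \<inter> \<tau> = {0}}"

text \<open>The product is over \<open>i = 0, \<dots>, d - 2\<close>. Real exponents are used since \<open>e\<close> may be
  half-integral.\<close>

definition cameron_liebler_set ::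
    "polar_type \<Rightarrow> nat \<Rightarrow> ('k::{field,finite} ^ 'n) set set \<Rightarrow> ('k ^ 'n) set set \<Rightarrow> real \<Rightarrow> bool" where
  "cameron_liebler_set T d S L x \<longleftrightarrow>
     (let q = real CARD('k); e = type_parameter T in
        L \<subseteq> generators d S \<and>
        x = real (card L) / (\<Prod>i<d-1. (q powr (e + real i) + 1)) \<and>
        (\<forall>\<pi>\<in>generators d S.
           real (card (disjoint_members L \<pi>)) =
             (x - (if \<pi> \<in> L then 1 else 0)) *
             q powr (real ((d - 1) choose 2) + e * real (d - 1))))"

text \<open>The two classes of generators of a hyperbolic quadric are the classes of this relation.\<close>

definition same_class :: "nat \<Rightarrow> ('k::{field,finite} ^ 'n) set set \<Rightarrow> ('k ^ 'n) set rel" where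
  "same_class d S = {(\<pi>, \<tau>). \<pi> \<in> generators d S \<and> \<tau> \<in> generators d S \<and>
     [proj_dim (\<pi> \<inter> \<tau>) = int d - 1] (mod 2)}"

definition generator_classes ::
    "nat \<Rightarrow> ('k::{field,finite} ^ 'n) set set \<Rightarrow> ('k ^ 'n) set set set" where
  "generator_classes d S = generators d S // same_class d S"

text \<open>Here the product is over \<open>i = 1, \<dots>, d - 2\<close>.\<close>

definition cameron_liebler_set_of_class ::
    "nat \<Rightarrow> ('k::{field,finite} ^ 'n) set set \<Rightarrow> ('k ^ 'n) set set \<Rightarrow> real \<Rightarrow> bool" where
  "cameron_liebler_set_of_class d G L x \<longleftrightarrow>
     (let q = real CARD('k) in
        L \<subseteq> G \<and>
        x = real (card L) / (\<Prod>i\<in>{1..<d-1}. (q ^ i + 1)) \<and>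
        (\<forall>\<pi>\<in>G.
           real (card (disjoint_members L \<pi>)) =
             (x - (if \<pi> \<in> L then 1 else 0)) * q ^ ((d - 1) choose 2)))"

end

theory Submission
  imports Defs
begin

text \<open>Let \<open>M\<close> be the power of \<open>q\<close> in the definition of a Cameron-Liebler set and \<open>P\<close> the product.
  Then \<open>x P = |L|\<close> and, by counting at one generator, \<open>x M\<close> are integers. When every factor of \<open>P\<close>
  is \<open>r ^ k + 1\<close> with \<open>k > 0\<close> and \<open>M\<close> is a power of \<open>r\<close>, they are coprime and \<open>x\<close> is an
  integer; in the Hermitian case one takes \<open>r\<^sup>2 = q\<close>.

  Only the generators of a hyperbolic quadric over a field of even order are left: the factor
  \<open>q ^ 0 + 1 = 2\<close> leaves \<open>2 x\<close> an integer. Let \<open>G\<close> be one class of generators. The generators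
  disjoint from a given one number a multiple of \<open>M\<close> and all lie in the same class, so counting
  disjoint pairs in \<open>G \<times> L\<close> shows that \<open>x |G|\<close> is an integer; and \<open>|G|\<close> is odd.\<close>

section \<open>Counting preliminaries\<close>

text \<open>Bezout: the gcd is an integer combination of \<open>a\<close> and \<open>b\<close>. Two
  integral multiples of the parameter with coprime factors therefore make the parameter itself
  integral.\<close>

lemma Ints_mult_gcd:
  fixes x :: real
  assumes "x * real a \<in> \<int>" "x * real b \<in> \<int>"
  shows "x * real (gcd a b) \<in> \<int>"
proof -
  obtain u v where uv: "u * int a + v * int b = gcd (int a) (int b)"
    using bezout_int by blast
  have "x * real (gcd a b) = x * of_int (gcd (int a) (int b))"
    by (metis gcd_int_int_eq of_int_of_nat_eq)
  also have "\<dots> = of_int u * (x * real a) + of_int v * (x * real b)"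
    unfolding uv[symmetric] by (simp add: algebra_simps)
  finally show ?thesis using assms by auto
qed

text \<open>The two-element sets \<open>{x, \<phi> x}\<close> partition \<open>X\<close>.\<close>

lemma even_card_involution:
  assumes "finite X" "\<And>x. x \<in> X \<Longrightarrow> \<phi> x \<in> X" "\<And>x. x \<in> X \<Longrightarrow> \<phi> (\<phi> x) = x" "\<And>x. x \<in> X \<Longrightarrow> \<phi> x \<noteq> x"
  shows "even (card X)"
proof -
  let ?C = "(\<lambda>x. {x, \<phi> x}) ` X"
  have "2 * card ?C = card (\<Union> ?C)"
  proof (rule card_partition)
    show "finite ?C" "finite (\<Union> ?C)" using assms(1) by auto
    show "card c = 2" if "c \<in> ?C" for c
      using that assms(4) by (auto simp: card_2_iff)
    show "c \<inter> c' = {}" if "c \<in> ?C" "c' \<in> ?C" "c \<noteq> c'" for c c'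
    proof -
      obtain x y where xy: "x \<in> X" "y \<in> X" "c = {x, \<phi> x}" "c' = {y, \<phi> y}" using \<open>c \<in> ?C\<close> \<open>c' \<in> ?C\<close> by auto
      then have "\<phi> (\<phi> x) = x" "\<phi> (\<phi> y) = y" using assms(3) by simp_all
      moreover from this have "x \<noteq> \<phi> y" "y \<noteq> \<phi> x" "x \<noteq> y" using \<open>c \<noteq> c'\<close> xy by auto
      ultimately show ?thesis unfolding xy by auto
    qed
  qed
  moreover have "\<Union> ?C = X" using assms(2) by auto
  ultimately show ?thesis by (metis dvd_triv_left)
qed

section \<open>Cardinalities of subspaces and of finite fields\<close>

lemma card_span_independent:
  fixes B :: "('k::{field,finite} ^ 'n) set"
  assumes "finite B" "vec.independent B"
  shows "card (vec.span B) = CARD('k) ^ card B"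
  using assms
proof (induction B)
  case empty
  then show ?case by simp
next
  case (insert a B)
  have a: "a \<notin> vec.span B" and B: "vec.independent B"
    using insert by (simp_all add: vec.independent_insert)
  have "bij_betw (\<lambda>(c, w). w + c *s a) (UNIV \<times> vec.span B) (vec.span (insert a B))"
  proof (rule bij_betw_imageI)
    show "inj_on (\<lambda>(c, w). w + c *s a) (UNIV \<times> vec.span B)"
    proof (rule inj_onI, clarsimp)
      fix c c' w w' assume w: "w \<in> vec.span B" "w' \<in> vec.span B" and eq: "w + c *s a = w' + c' *s a"
      have "(c - c') *s a = w' - w" using eq by (simp add: vec.scale_left_diff_distrib algebra_simps)
      then have "(c - c') *s a \<in> vec.span B" using w by (simp add: vec.span_diff)
      then have "inverse (c - c') *s ((c - c') *s a) \<in> vec.span B" by (rule vec.span_scale)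
      moreover have "inverse (c - c') *s ((c - c') *s a) = a" if "c \<noteq> c'"
        using that by (metis vec.scale_scale left_inverse vec.scale_one right_minus_eq)
      ultimately have "c = c'" using a by metis
      then show "c = c' \<and> w = w'" using eq by simp
    qed
    show "(\<lambda>(c, w). w + c *s a) ` (UNIV \<times> vec.span B) = vec.span (insert a B)"
    proof -
      have "v \<in> (\<lambda>(c, w). w + c *s a) ` (UNIV \<times> vec.span B)" if "v - c *s a \<in> vec.span B" for v c
        by (rule image_eqI[of _ _ "(c, v - c *s a)"]) (use that in auto)
      then show ?thesis by (auto simp: vec.span_insert)
        (metis add.commute add_diff_cancel_left')
    qed
  qed
  then show ?case using bij_betw_same_card[of _ "UNIV \<times> vec.span B"] insert B
    by (fastforce simp: card_cartesian_product)
qed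

lemma card_subspace:
  fixes U :: "('k::{field,finite} ^ 'n) set"
  assumes "vec.subspace U"
  shows "card U = CARD('k) ^ vec.dim U"
proof -
  obtain B where B: "B \<subseteq> U" "vec.independent B" "U \<subseteq> vec.span B" "card B = vec.dim U"
    using vec.basis_exists by blast
  then have "vec.span B = U" using assms by (simp add: vec.span_minimal subset_antisym)
  then show ?thesis using card_span_independent[of B] B by simp
qed

lemma one_less_card_field: "1 < CARD('k::{field,finite})"
  using card_mono[of UNIV "{0, 1 :: 'k}"] by simp

text \<open>If 2 were nonzero, negation would pair off the nonzero elements and the order of the
  field would be odd.\<close>

lemma char_2_if_even_card:
  assumes "even CARD('k::{field,finite})"
  shows "(2::'k) = 0"
proof (rule ccontr)
  assume 2: "(2::'k) \<noteq> 0"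
  have "even (card (UNIV - {0 :: 'k}))"
  proof (rule even_card_involution[of _ uminus])
    show "- x \<noteq> x" if "x \<in> UNIV - {0}" for x :: 'k
    proof
      assume "- x = x"
      then have "2 * x = 0" by (metis add.right_inverse mult_2)
      then show False using 2 that by simp
    qed
  qed auto
  then show False using assms one_less_card_field[where 'k='k] by (simp add: card_Diff_subset)
qed

text \<open>The field has dimension 2 over the fixed field of \<open>\<sigma>\<close>, with basis 1
  and any \<open>t\<close> moved by \<open>\<sigma>\<close>. For Hermitian spaces this supplies a
  square root of the order \<open>q\<close>.\<close>

lemma card_involutory_field:
  assumes "involutory_automorphism (\<sigma> :: 'k::{field,finite} \<Rightarrow> 'k)"
  shows "CARD('k) = (card {a. \<sigma> a = a})\<^sup>2"
proof -
  have add: "\<sigma> (a + b) = \<sigma> a + \<sigma> b" and mult: "\<sigma> (a * b) = \<sigma> a * \<sigma> b" 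
    and inv: "\<sigma> (\<sigma> a) = a" for a b
    using assms unfolding involutory_automorphism_def by (auto simp: fun_eq_iff)
  obtain t where t: "\<sigma> t \<noteq> t" 
    using assms unfolding involutory_automorphism_def by (auto simp: fun_eq_iff)
  have diff: "\<sigma> (a - b) = \<sigma> a - \<sigma> b" for a b
    by (metis add add_diff_cancel diff_add_cancel)
  let ?F = "{a. \<sigma> a = a}"
  have "bij_betw (\<lambda>(a, b). a + b * t) (?F \<times> ?F) UNIV"
  proof (rule bij_betw_imageI)
    show "inj_on (\<lambda>(a, b). a + b * t) (?F \<times> ?F)"
    proof (rule inj_onI, clarsimp)
      fix a b a' b' assume F: "\<sigma> a = a" "\<sigma> b = b" "\<sigma> a' = a'" "\<sigma> b' = b'" and eq: "a + b * t = a' + b' * t"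
      then have "a + b * \<sigma> t = a' + b' * \<sigma> t" by (metis add mult)
      then have "(a + b * \<sigma> t) - (a + b * t) = (a' + b' * \<sigma> t) - (a' + b' * t)" using eq by simp
      then have "(b - b') * (\<sigma> t - t) = 0" by (simp add: algebra_simps)
      then have "b = b'" using t by simp
      then show "a = a' \<and> b = b'" using eq by simp
    qed
    have "v \<in> (\<lambda>(a, b). a + b * t) ` (?F \<times> ?F)" for v
    proof (rule image_eqI)
      \<comment> \<open>Forced by \<open>v = a + b * t\<close> with \<open>a\<close> and
        \<open>b\<close> fixed: subtracting the conjugate equation leaves
        \<open>v - \<sigma> v = b * (t - \<sigma> t)\<close>.\<close>
      let ?b = "(v - \<sigma> v) / (t - \<sigma> t)"
      have div: "\<sigma> (a / b) * \<sigma> b = \<sigma> a" if "b \<noteq> 0" for a b using that by (metis mult nonzero_eq_divide_eq)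
      have "\<sigma> ?b * (\<sigma> t - t) = \<sigma> v - v" using div[of "t - \<sigma> t" "v - \<sigma> v"] t by (simp add: diff inv)
      then have b: "\<sigma> ?b = ?b" using t by (metis eq_iff_diff_eq_0 minus_diff_eq minus_divide_divide nonzero_eq_divide_eq)
      have "?b * (t - \<sigma> t) = v - \<sigma> v" using t by simp
      then have "\<sigma> (v - ?b * t) = v - ?b * t" unfolding diff mult b by (simp add: right_diff_distrib)  (metis add_diff_cancel_left' diff_add_cancel diff_diff_eq2)
      with b show "(v - ?b * t, ?b) \<in> ?F \<times> ?F" by simp
    qed simp
    then show "(\<lambda>(a, b). a + b * t) ` (?F \<times> ?F) = UNIV" by blast
  qed
  from bij_betw_same_card[OF this] show ?thesis
    by (simp add: card_cartesian_product power2_eq_square)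
qed

section \<open>Bilinear forms over finite fields\<close>

text \<open>Symmetry is left out so that the locale covers, besides the polar form, the form
  \<open>polar_form Q (P v) w\<close> built from a projection \<open>P\<close>.\<close>

locale bilinear_form =
  fixes f :: "'k::{field,finite} ^ 'n \<Rightarrow> 'k ^ 'n \<Rightarrow> 'k"
  assumes add_left: "f (u + v) w = f u w + f v w"
    and scale_left: "f (c *s u) w = c * f u w"
    and add_right: "f u (v + w) = f u v + f u w"
    and scale_right: "f u (c *s v) = c * f u v"
begin

lemma transposed: "bilinear_form (\<lambda>u v. f v u)"
  by unfold_locales (simp_all add: add_left scale_left add_right scale_right)

lemma zero_left [simp]: "f 0 w = 0"
  using scale_left[of 0 0 w] by simp

lemma zero_right [simp]: "f w 0 = 0"
  using scale_right[of w 0 0] by simp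

lemma minus_left: "f (- u) w = - f u w"
  using scale_left[of "-1" u w] by simp

lemma minus_right: "f u (- w) = - f u w"
  using scale_right[of u "-1" w] by simp

lemma diff_left: "f (u - v) w = f u w - f v w"
  using add_left[of u "- v" w] by (simp add: minus_left)

lemma diff_right: "f u (v - w) = f u v - f u w"
  using add_right[of u v "- w"] by (simp add: minus_right)

lemma sum_right: "f u (sum g I) = (\<Sum>i\<in>I. f u (g i))"
  by (induction I rule: infinite_finite_induct) (simp_all add: add_right)

lemmas bilinear_simps = add_left scale_left add_right scale_right minus_left minus_right
  diff_left diff_right

text \<open>\<open>W\<close> is the direct sum of the kernel and the line through \<open>w0\<close>;
  applying \<open>f u\<close> reads off the coefficient at \<open>w0\<close>.\<close>

lemma card_kernel:
  assumes W: "vec.subspace W" and w0: "w0 \<in> W" "f u w0 \<noteq> 0"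
  shows "card W = CARD('k) * card {w \<in> W. f u w = 0}"
proof -
  let ?K = "{w \<in> W. f u w = 0}"
  have "bij_betw (\<lambda>(c, w). w + c *s w0) (UNIV \<times> ?K) W"
  proof (rule bij_betw_imageI)
    show "inj_on (\<lambda>(c, w). w + c *s w0) (UNIV \<times> ?K)"
    proof (rule inj_onI, clarsimp)
      fix c c' w w' assume w: "f u w = 0" "f u w' = 0" and eq: "w + c *s w0 = w' + c' *s w0"
      from eq have "f u (w + c *s w0) = f u (w' + c' *s w0)" by simp
      then have "c = c'" using w w0 by (simp add: bilinear_simps)
      then show "c = c' \<and> w = w'" using eq by simp
    qed
    have "v \<in> (\<lambda>(c, w). w + c *s w0) ` (UNIV \<times> ?K)" if "v \<in> W" for v
    proof (rule image_eqI[of _ _ "(f u v / f u w0, v - (f u v / f u w0) *s w0)"])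
      show "(f u v / f u w0, v - (f u v / f u w0) *s w0) \<in> UNIV \<times> ?K"
        using that W w0 by (simp add: bilinear_simps vec.subspace_diff vec.subspace_scale)
    qed simp
    then show "(\<lambda>(c, w). w + c *s w0) ` (UNIV \<times> ?K) = W"
      using W w0 by (auto intro: vec.subspace_add vec.subspace_scale)
  qed
  from bij_betw_same_card[OF this] show ?thesis
    by (simp add: card_cartesian_product)
qed

text \<open>A vector \<open>u\<close> that annihilates \<open>W\<close> is orthogonal to all of
  \<open>W\<close>, any other to a fraction \<open>1/q\<close> of it. Multiplying by
  \<open>q\<close> and moving the negative term to the left keeps the count within the
  naturals.\<close>

lemma card_orthogonal_pairs:
  assumes W: "vec.subspace W"
  shows "CARD('k) * card {(u, w) \<in> U \<times> W. f u w = 0} + card {u \<in> U. \<forall>w\<in>W. f u w = 0} * card W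
    = CARD('k) * card {u \<in> U. \<forall>w\<in>W. f u w = 0} * card W + card U * card W"
proof -
  let ?U0 = "{u \<in> U. \<forall>w\<in>W. f u w = 0}"
  let ?q = "CARD('k)"
  have "{(u, w) \<in> U \<times> W. f u w = 0} = (SIGMA u:U. {w \<in> W. f u w = 0})" by auto
  then have "?q * card {(u, w) \<in> U \<times> W. f u w = 0} = (\<Sum>u\<in>U. ?q * card {w \<in> W. f u w = 0})"
    by (simp add: sum_distrib_left)
  also have "\<dots> = (\<Sum>u\<in>U. if u \<in> ?U0 then ?q * card W else card W)"
  proof (rule sum.cong)
    fix u assume u: "u \<in> U"
    show "?q * card {w \<in> W. f u w = 0} = (if u \<in> ?U0 then ?q * card W else card W)"
    proof (cases "u \<in> ?U0")
      case True
      then have "{w \<in> W. f u w = 0} = W" by auto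
      then show ?thesis using True by simp
    next
      case False
      then show ?thesis using card_kernel[OF W] u by auto
    qed
  qed simp
  also have "\<dots> = (\<Sum>u\<in>U - ?U0. if u \<in> ?U0 then ?q * card W else card W)
      + (\<Sum>u\<in>?U0. if u \<in> ?U0 then ?q * card W else card W)"
    by (rule sum.subset_diff) auto
  also have "\<dots> = card (U - ?U0) * card W + card ?U0 * (?q * card W)"
  proof -
    have "(\<Sum>u\<in>U - ?U0. if u \<in> ?U0 then ?q * card W else card W) = (\<Sum>u\<in>U - ?U0. card W)"
      by (rule sum.cong) auto
    moreover have "(\<Sum>u\<in>?U0. if u \<in> ?U0 then ?q * card W else card W) = (\<Sum>u\<in>?U0. ?q * card W)"
      by (rule sum.cong) auto
    ultimately show ?thesis by (simp only: sum_constant of_nat_id)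
  qed
  finally have "?q * card {(u, w) \<in> U \<times> W. f u w = 0}
    = card (U - ?U0) * card W + card ?U0 * (?q * card W)" .
  moreover have "card (U - ?U0) + card ?U0 = card U"
    by (metis (no_types, lifting) card_Diff_subset card_mono finite le_add_diff_inverse2 mem_Collect_eq subsetI)
  then have "card U * card W = card (U - ?U0) * card W + card ?U0 * card W"
    by (simp only: add_mult_distrib[symmetric])
  ultimately show ?thesis by (simp only: mult_ac)
qed

text \<open>Both sides come from counting the pairs \<open>(u, w)\<close> with \<open>f u w = 0\<close> in the two possible orders.\<close>

lemma card_annihilators:
  assumes U: "vec.subspace U" and W: "vec.subspace W"
  shows "card {u \<in> U. \<forall>w\<in>W. f u w = 0} * card W = card {w \<in> W. \<forall>u\<in>U. f u w = 0} * card U"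
proof -
  let ?U0 = "{u \<in> U. \<forall>w\<in>W. f u w = 0}" and ?W0 = "{w \<in> W. \<forall>u\<in>U. f u w = 0}"
  let ?Z = "{(u, w) \<in> U \<times> W. f u w = 0}" and ?Z' = "{(w, u) \<in> W \<times> U. f u w = 0}"
  have "card ?Z' = card ?Z"
    by (rule bij_betw_same_card[of prod.swap]) (auto simp: bij_betw_def inj_on_def image_def)
  then have "CARD('k) * card ?Z + card ?W0 * card U = CARD('k) * card ?W0 * card U + card W * card U"
    using bilinear_form.card_orthogonal_pairs[OF transposed U, of W] by simp
  with card_orthogonal_pairs[OF W, of U]
  have "CARD('k) * (card ?U0 * card W) + card ?W0 * card U
    = CARD('k) * (card ?W0 * card U) + card ?U0 * card W"
    unfolding mult.assoc[symmetric] using mult.commute[of "card U" "card W"] by linarith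
  \<comment> \<open>Over the integers the factor \<open>q - 1\<close> can be split off and then
    cancelled, as \<open>q > 1\<close>.\<close>
  then have "int (CARD('k)) * (card ?U0 * card W) - card ?U0 * card W
    = int (CARD('k)) * (card ?W0 * card U) - card ?W0 * card U"
    unfolding of_nat_mult[symmetric] by linarith
  then have "(int (CARD('k)) - 1) * (card ?U0 * card W) = (int (CARD('k)) - 1) * (card ?W0 * card U)"
    by (simp only: left_diff_distrib)
  then have "int (card ?U0 * card W) = int (card ?W0 * card U)"
    using one_less_card_field[where 'k='k] by (simp only: mult_cancel_left) auto
  then show ?thesis by linarith
qed

text \<open>Splitting off a hyperbolic pair divides the cardinality by \<open>q\<^sup>2\<close> and keeps the radical.\<close>

lemma card_alternating:
  assumes "vec.subspace W" and "\<And>v. v \<in> W \<Longrightarrow> f v v = 0"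
  shows "\<exists>k. card W = card {v \<in> W. \<forall>w\<in>W. f v w = 0} * CARD('k) ^ (2 * k)"
  using assms
proof (induction "card W" arbitrary: W rule: less_induct)
  case less
  note W = less.prems(1) and alt = less.prems(2)
  let ?R = "\<lambda>W. {v \<in> W. \<forall>w\<in>W. f v w = 0}"
  show ?case
  proof (cases "?R W = W")
    case True
    then show ?thesis by (intro exI[of _ 0]) simp
  next
    case False
    then obtain v u where vu: "v \<in> W" "u \<in> W" "f v u \<noteq> 0" by blast
    have skew: "f a b = - f b a" if "a \<in> W" "b \<in> W" for a b
    proof -
      have "f (a + b) (a + b) = 0" using alt that W by (blast intro: vec.subspace_add)
      then show ?thesis using alt that by (simp add: bilinear_simps add_eq_0_iff2)
    qed
    \<comment> \<open>\<open>W'\<close> will be the orthogonal complement in \<open>W\<close> of the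
      hyperbolic pair \<open>v\<close>, \<open>u\<close>. Since \<open>v\<close> lies in
      \<open>H\<close> and \<open>f u v\<close> is nonzero, each of the two conditions divides the
      cardinality by \<open>q\<close>.\<close>
    define H where "H = {w \<in> W. f v w = 0}"
    define W' where "W' = {w \<in> H. f u w = 0}"
    have H: "vec.subspace H" using W
      by (auto simp: H_def vec.subspace_def bilinear_simps)
    have W': "vec.subspace W'" using H
      by (auto simp: W'_def vec.subspace_def bilinear_simps)
    have v: "v \<in> H" "f u v \<noteq> 0" using vu alt skew[of u v] by (auto simp: H_def)
    have card: "card W = CARD('k) * (CARD('k) * card W')"
      using card_kernel[OF W, of u v] card_kernel[OF H, of v u] vu v by (simp add: H_def W'_def)
    have sub: "W' \<subseteq> W" by (auto simp: W'_def H_def)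
    have "card W' > 0" using vec.subspace_0[OF W'] by (auto simp: card_gt_0_iff)
    then have "card W' < CARD('k) * card W'" using one_less_card_field[where 'k='k] by simp
    also have "\<dots> \<le> card W" unfolding card using one_less_card_field[where 'k='k] by simp
    finally have "card W' < card W" .
    then obtain k where k: "card W' = card (?R W') * CARD('k) ^ (2 * k)"
      using less.hyps[of W'] W' sub alt by blast
    have "?R W' = ?R W"
    proof (intro equalityI subsetI)
      fix r assume "r \<in> ?R W"
      then show "r \<in> ?R W'" using vu skew[of r v] skew[of r u] sub by (auto simp: W'_def H_def)
    next
      fix r assume r: "r \<in> ?R W'"
      then have rW: "r \<in> W" and rv: "f r v = 0" and ru: "f r u = 0"
        using vu skew[of r v] skew[of r u] by (auto simp: W'_def H_def)
      have "f r w = 0" if w: "w \<in> W" for w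
      proof -
        \<comment> \<open>Removing the components along \<open>u\<close> and \<open>v\<close>
          projects \<open>w\<close> to \<open>W'\<close>.\<close>
        let ?w = "w - (f v w / f v u) *s u - (f u w / f u v) *s v"
        have "?w \<in> W" using W w vu by (simp add: vec.subspace_diff vec.subspace_scale)
        then have "?w \<in> W'" using vu v alt by (simp add: W'_def H_def bilinear_simps)
        then have "f r ?w = 0" using r by blast
        then show ?thesis using rv ru by (simp add: bilinear_simps)
      qed
      then show "r \<in> ?R W" using rW by blast
    qed
    with card k show ?thesis by (intro exI[of _ "Suc k"]) (simp add: mult_ac)
  qed
qed

end

section \<open>Hyperbolic quadrics\<close>

lemma sesquilinear_id_bilinear_form:
  assumes "sesquilinear id f"
  shows "bilinear_form f"
proof -
  have "Vector_Spaces.linear (*s) (*) (\<lambda>u. f u v)" for v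
    using assms unfolding sesquilinear_def by blast
  then have "f (u + w) v = f u v + f w v" "f (c *s u) v = c * f u v" for u v w c
    by (simp_all add: Vector_Spaces.linear_iff)
  with assms show ?thesis unfolding sesquilinear_def by unfold_locales auto
qed

lemma dim_eq_if_card_eq:
  fixes U :: "('k::{field,finite} ^ 'n) set"
  assumes "vec.subspace U" "card U = CARD('k) ^ m"
  shows "vec.dim U = m"
  using card_subspace[OF assms(1)] assms(2) one_less_card_field[where 'k='k] by simp

lemma subspace_scale_cancel:
  fixes U :: "('k::field ^ 'n) set"
  assumes "vec.subspace U" "c *s v \<in> U" "v \<notin> U"
  shows "c = 0"
proof (rule ccontr)
  assume "c \<noteq> 0"
  then have "inverse c *s (c *s v) = v" by simp
  then show False using vec.subspace_scale[OF assms(1,2), of "inverse c"] assms(3) by simp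
qed

text \<open>Hyperbolicity enters through hypotheses of the form \<open>U \<in> gens\<close>: a
  totally singular subspace of half the dimension of the space.\<close>

locale hyperbolic_quadric =
  fixes Q :: "'k::{field,finite} ^ 'n \<Rightarrow> 'k" and d :: nat
  assumes quadratic: "quadratic_form Q"
    and nondeg: "nondegenerate_quadratic Q"
    and card_index: "CARD('n) = 2 * d"
begin

sublocale bilinear_form "polar_form Q"
  using quadratic by (auto simp: quadratic_form_def intro: sesquilinear_id_bilinear_form)

abbreviation gens :: "('k ^ 'n) set set" where
  "gens \<equiv> generators d (singular_subspaces Q)"

lemma Q_scale: "Q (c *s v) = c\<^sup>2 * Q v"
  using quadratic by (simp add: quadratic_form_def)

lemma Q_add: "Q (u + v) = Q u + Q v + polar_form Q u v"
  by (simp add: polar_form_def)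

lemma polar_commute: "polar_form Q u v = polar_form Q v u"
  by (simp add: polar_form_def add.commute)

lemma gens_iff:
  "U \<in> gens \<longleftrightarrow> vec.subspace U \<and> (\<forall>u\<in>U. Q u = 0) \<and> card U = CARD('k) ^ d"
proof -
  have "card U = CARD('k) ^ d \<longleftrightarrow> vec.dim U = d" if "vec.subspace U"
    using that card_subspace dim_eq_if_card_eq by metis
  then show ?thesis by (auto simp: generators_def singular_subspaces_def proj_dim_def)
qed

lemma gensD:
  assumes "U \<in> gens"
  shows "vec.subspace U" "\<And>u. u \<in> U \<Longrightarrow> Q u = 0" "card U = CARD('k) ^ d" "vec.dim U = d"
  using assms dim_eq_if_card_eq by (auto simp: gens_iff)

lemma polar_gens:
  assumes "U \<in> gens" "u \<in> U" "v \<in> U"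
  shows "polar_form Q u v = 0"
  using assms gensD[OF assms(1)] by (simp add: polar_form_def vec.subspace_add)

lemma card_space: "card (UNIV :: ('k ^ 'n) set) = CARD('k) ^ d * CARD('k) ^ d"
  using card_subspace[of "UNIV :: ('k ^ 'n) set"]
  by (simp add: vec.dim_UNIV card_index power_add[symmetric] mult_2)

text \<open>As \<open>Q\<close> vanishes on \<open>U\<close>, non-degeneracy leaves only 0 in
  \<open>U\<close> orthogonal to the whole space. Hence the perp of \<open>U\<close> has
  \<open>q ^ d\<close> elements; it contains \<open>U\<close>, so it equals
  \<open>U\<close>.\<close>

lemma perp_gens:
  assumes U: "U \<in> gens" and v: "\<And>u. u \<in> U \<Longrightarrow> polar_form Q u v = 0"
  shows "v \<in> U"
proof -
  let ?P = "{w \<in> UNIV. \<forall>u\<in>U. polar_form Q u w = 0}"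
  have "{u \<in> U. \<forall>w\<in>UNIV. polar_form Q u w = 0} = {0}"
    using nondeg gensD[OF U] by (auto simp: nondegenerate_quadratic_def vec.subspace_0)
  then have "card (UNIV :: ('k ^ 'n) set) = card ?P * card U"
    using card_annihilators[OF gensD(1)[OF U], of UNIV] by simp
  then have "card ?P = card U"
    using gensD(3)[OF U] one_less_card_field[where 'k='k] unfolding card_space by simp
  moreover have "U \<subseteq> ?P" using polar_gens[OF U] by auto
  ultimately have "U = ?P" by (intro card_subset_eq) auto
  then show ?thesis using v by blast
qed

text \<open>Trivial intersection makes the sum map injective, and both sides have
  \<open>q ^ (2 * d)\<close> elements.\<close>

lemma decomposition:
  assumes \<tau>: "\<tau> \<in> gens" and \<rho>: "\<rho> \<in> gens" and disj: "\<tau> \<inter> \<rho> = {0}"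
  shows "bij_betw (\<lambda>(t, r). t + r) (\<tau> \<times> \<rho>) UNIV"
proof -
  have inj: "inj_on (\<lambda>(t, r). t + r) (\<tau> \<times> \<rho>)"
  proof (rule inj_onI, clarsimp)
    fix t r t' r' assume A: "t \<in> \<tau>" "r \<in> \<rho>" "t' \<in> \<tau>" "r' \<in> \<rho>" and eq: "t + r = t' + r'"
    have "t - t' = (t + r) - (t' + r)" by simp
    also have "\<dots> = r' - r" unfolding eq by simp
    finally have "t - t' = r' - r" .
    moreover have "t - t' \<in> \<tau>" "r' - r \<in> \<rho>"
      using A gensD(1)[OF \<tau>] gensD(1)[OF \<rho>] by (simp_all add: vec.subspace_diff)
    ultimately have "t - t' \<in> \<tau> \<inter> \<rho>" by simp
    then have "t - t' = 0" unfolding disj by simp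
    then show "t = t' \<and> r = r'" using eq by simp
  qed
  have "card ((\<lambda>(t, r). t + r) ` (\<tau> \<times> \<rho>)) = card (UNIV :: ('k ^ 'n) set)"
    unfolding card_image[OF inj] card_cartesian_product gensD(3)[OF \<tau>] gensD(3)[OF \<rho>] card_space ..
  then have "(\<lambda>(t, r). t + r) ` (\<tau> \<times> \<rho>) = (UNIV :: ('k ^ 'n) set)"
    by (intro card_subset_eq) simp_all
  with inj show ?thesis by (simp add: bij_betw_def)
qed

text \<open>If \<open>P\<close> is the projection to \<open>\<tau>\<close> along \<open>\<rho>\<close>, then \<open>(v, w) \<mapsto> B (P v) w\<close> is alternating
  on \<open>\<pi>\<close>, with radical \<open>(\<pi> \<inter> \<tau>) \<oplus> (\<pi> \<inter> \<rho>)\<close>.\<close>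

lemma even_dim_disjoint:
  assumes \<tau>: "\<tau> \<in> gens" and \<rho>: "\<rho> \<in> gens" and disj: "\<tau> \<inter> \<rho> = {0}" and \<pi>: "\<pi> \<in> gens"
  shows "even (vec.dim (\<tau> \<inter> \<pi>) + vec.dim (\<rho> \<inter> \<pi>) + d)"
proof -
  note sub = gensD(1)[OF \<tau>] gensD(1)[OF \<rho>] gensD(1)[OF \<pi>]
  define P where "P v = (SOME t. t \<in> \<tau> \<and> v - t \<in> \<rho>)" for v
  have ex: "\<exists>t. t \<in> \<tau> \<and> v - t \<in> \<rho>" for v
  proof -
    have "v \<in> (\<lambda>(t, r). t + r) ` (\<tau> \<times> \<rho>)"
      using decomposition[OF \<tau> \<rho> disj] by (auto simp: bij_betw_def)
    then show ?thesis by force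
  qed
  have P: "P v \<in> \<tau>" "v - P v \<in> \<rho>" for v
    using someI_ex[OF ex, of v] unfolding P_def by auto
  have P_eq: "P v = t" if "t \<in> \<tau>" "v - t \<in> \<rho>" for v t
  proof -
    have "P v - t \<in> \<tau>" using P that sub by (simp add: vec.subspace_diff)
    moreover have "(v - t) - (v - P v) \<in> \<rho>" using P that sub by (simp only: vec.subspace_diff)
    ultimately have "P v - t \<in> \<tau> \<inter> \<rho>" by simp
    then show ?thesis using disj by simp
  qed
  have P_add: "P (v + w) = P v + P w" for v w
  proof (rule P_eq)
    have "(v - P v) + (w - P w) \<in> \<rho>" using P sub by (simp only: vec.subspace_add)
    then show "v + w - (P v + P w) \<in> \<rho>" by (simp add: algebra_simps)
  qed (use P sub in \<open>simp add: vec.subspace_add\<close>)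
  have P_scale: "P (c *s v) = c *s P v" for c v
  proof (rule P_eq)
    have "c *s (v - P v) \<in> \<rho>" using P sub by (simp only: vec.subspace_scale)
    then show "c *s v - c *s P v \<in> \<rho>" by (simp add: vec.scale_right_diff_distrib)
  qed (use P sub in \<open>simp add: vec.subspace_scale\<close>)
  interpret F: bilinear_form "\<lambda>v w. polar_form Q (P v) w"
    by unfold_locales (simp_all add: P_add P_scale bilinear_simps)
  have "polar_form Q (P v) v = 0" if "v \<in> \<pi>" for v
  proof -
    \<comment> \<open>The polar form vanishes on \<open>\<tau>\<close>, so \<open>P v\<close> may be
      subtracted; what remains is a combination of the values of \<open>Q\<close> at the singular
      vectors \<open>v\<close>, \<open>P v\<close> and \<open>v - P v\<close>.\<close>
    have "polar_form Q (P v) v = polar_form Q (P v) (v - P v)"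
      using polar_gens[OF \<tau> P(1) P(1)] by (simp add: diff_right)
    also have "\<dots> = Q (P v + (v - P v)) - Q (P v) - Q (v - P v)"
      by (simp only: polar_form_def)
    also have "\<dots> = 0" using gensD(2)[OF \<tau> P(1)] gensD(2)[OF \<rho> P(2)] gensD(2)[OF \<pi> that] by simp
    finally show ?thesis .
  qed
  with F.card_alternating[OF sub(3)] obtain k where
    k: "card \<pi> = card {v \<in> \<pi>. \<forall>w\<in>\<pi>. polar_form Q (P v) w = 0} * CARD('k) ^ (2 * k)"
    by blast
  \<comment> \<open>\<open>\<pi>\<close> is its own perp, so \<open>P v\<close> is orthogonal to
    \<open>\<pi>\<close> exactly when it lies in \<open>\<pi>\<close>.\<close>
  have "{v \<in> \<pi>. \<forall>w\<in>\<pi>. polar_form Q (P v) w = 0} = {v \<in> \<pi>. P v \<in> \<pi>}"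
    using perp_gens[OF \<pi>] polar_gens[OF \<pi>] polar_commute by metis
  also have "\<dots> = (\<lambda>(t, r). t + r) ` ((\<tau> \<inter> \<pi>) \<times> (\<rho> \<inter> \<pi>))"
  proof (intro equalityI subsetI)
    fix v assume "v \<in> {v \<in> \<pi>. P v \<in> \<pi>}"
    then show "v \<in> (\<lambda>(t, r). t + r) ` ((\<tau> \<inter> \<pi>) \<times> (\<rho> \<inter> \<pi>))"
      using P[of v] sub by (intro image_eqI[of _ _ "(P v, v - P v)"]) (auto intro: vec.subspace_diff)
  next
    fix v assume "v \<in> (\<lambda>(t, r). t + r) ` ((\<tau> \<inter> \<pi>) \<times> (\<rho> \<inter> \<pi>))"
    then obtain t r where tr: "t \<in> \<tau>" "t \<in> \<pi>" "r \<in> \<rho>" "r \<in> \<pi>" "v = t + r" by auto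
    then have "P v = t" by (intro P_eq) auto
    then show "v \<in> {v \<in> \<pi>. P v \<in> \<pi>}" using tr sub by (simp add: vec.subspace_add)
  qed
  also have "card \<dots> = card (\<tau> \<inter> \<pi>) * card (\<rho> \<inter> \<pi>)"
    using decomposition[OF \<tau> \<rho> disj]
    by (subst card_image) (auto simp: bij_betw_def card_cartesian_product elim: inj_on_subset)
  finally have "CARD('k) ^ d = CARD('k) ^ (vec.dim (\<tau> \<inter> \<pi>) + vec.dim (\<rho> \<inter> \<pi>) + 2 * k)"
    using k gensD(3)[OF \<pi>] sub by (simp add: card_subspace vec.subspace_inter power_add)
  then have "d = vec.dim (\<tau> \<inter> \<pi>) + vec.dim (\<rho> \<inter> \<pi>) + 2 * k"
    using one_less_card_field[where 'k='k] by simp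
  then show ?thesis by presburger
qed

section \<open>Siegel transformations and the parity of the size of a class\<close>

lemma image_gens:
  assumes "U \<in> gens" "inj T" "\<And>v w. T (v + w) = T v + T w" "\<And>c v. T (c *s v) = c *s T v"
    and "\<And>v. Q (T v) = Q v"
  shows "T ` U \<in> gens"
proof -
  have "T 0 = 0" using assms(4)[of 0 0] by simp
  then have "vec.subspace (T ` U)"
    using gensD(1)[OF assms(1)] unfolding vec.subspace_def
    by (auto simp: assms(3,4)[symmetric])
  moreover have "card (T ` U) = card U"
    using assms(2) by (intro card_image) (auto elim: inj_on_subset)
  ultimately show ?thesis using assms(1,5) by (auto simp: gens_iff)
qed

text \<open>The class of \<open>\<pi>\<^sub>0\<close>, described by intersecting with this one
  member. The condition is the congruence of \<open>same_class\<close> in vector space dimensions,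
  where the two shifts by 1 cancel.\<close>

definition gens_class :: "('k ^ 'n) set \<Rightarrow> ('k ^ 'n) set set" where
  "gens_class \<pi>\<^sub>0 = {\<pi> \<in> gens. even (vec.dim (\<pi> \<inter> \<pi>\<^sub>0) + d)}"

definition siegel :: "'k ^ 'n \<Rightarrow> 'k ^ 'n \<Rightarrow> 'k ^ 'n \<Rightarrow> 'k ^ 'n" where
  "siegel a b v = v + (polar_form Q v a *s b - polar_form Q v b *s a)"

text \<open>The displacement of \<open>v\<close> lies in \<open>\<pi>\<^sub>0\<close>, so it is
  singular, and it is orthogonal to \<open>v\<close> because the two products cancel; hence
  \<open>Q\<close> is preserved. A second application repeats the same displacement, and twice it is
  0 in characteristic 2.\<close>

lemma siegel:
  assumes two: "(2::'k) = 0" and \<pi>0: "\<pi>\<^sub>0 \<in> gens" and ab: "a \<in> \<pi>\<^sub>0" "b \<in> \<pi>\<^sub>0"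
  shows "siegel a b (v + w) = siegel a b v + siegel a b w"
    and "siegel a b (c *s v) = c *s siegel a b v"
    and "Q (siegel a b v) = Q v"
    and "siegel a b (siegel a b v) = v"
    and "v \<in> \<pi>\<^sub>0 \<Longrightarrow> siegel a b v = v"
proof -
  let ?B = "polar_form Q"
  have z: "?B a a = 0" "?B a b = 0" "?B b a = 0" "?B b b = 0" "Q a = 0" "Q b = 0"
    using polar_gens[OF \<pi>0] gensD(2)[OF \<pi>0] ab by auto
  show "siegel a b (v + w) = siegel a b v + siegel a b w"
    by (simp add: siegel_def bilinear_simps vec.scale_left_distrib algebra_simps)
  show "siegel a b (c *s v) = c *s siegel a b v"
    by (simp add: siegel_def bilinear_simps vec.scale_right_distrib vec.scale_right_diff_distrib)
  have "?B v a *s b - ?B v b *s a \<in> \<pi>\<^sub>0"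
    using ab gensD(1)[OF \<pi>0] by (simp add: vec.subspace_diff vec.subspace_scale)
  then have "Q (?B v a *s b - ?B v b *s a) = 0" using gensD(2)[OF \<pi>0] by blast
  then show "Q (siegel a b v) = Q v"
    unfolding siegel_def by (simp add: Q_add bilinear_simps mult.commute)
  have dbl: "u + u = 0" for u :: "'k ^ 'n"
    using two vec.scale_left_distrib[of 1 1 u] by simp
  let ?u = "?B v a *s b - ?B v b *s a"
  have "siegel a b (siegel a b v) = v + (?u + ?u)"
    by (simp add: siegel_def bilinear_simps z algebra_simps)
  then show "siegel a b (siegel a b v) = v" using dbl[of ?u] by simp
  show "siegel a b v = v" if "v \<in> \<pi>\<^sub>0"
    using polar_gens[OF \<pi>0] ab that by (simp add: siegel_def)
qed

text \<open>For \<open>I = \<pi> \<inter> \<pi>\<^sub>0\<close> of codimension at least 2 in \<open>\<pi>\<^sub>0\<close>, a Siegel transformation with centre in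
  \<open>\<pi>\<^sub>0\<close> chosen according to \<open>I\<close> moves \<open>\<pi>\<close> and keeps \<open>I\<close>. In characteristic 2 this is a
  fixed-point-free involution on the class without \<open>\<pi>\<^sub>0\<close>.\<close>

lemma odd_card_gens_class:
  assumes two: "(2::'k) = 0" and \<pi>0: "\<pi>\<^sub>0 \<in> gens"
  shows "odd (card (gens_class \<pi>\<^sub>0))"
proof -
  define X where "X = gens_class \<pi>\<^sub>0 - {\<pi>\<^sub>0}"
  define good where "good I a b \<longleftrightarrow> a \<in> \<pi>\<^sub>0 \<and> b \<in> \<pi>\<^sub>0 \<and> a \<notin> I \<and> b \<notin> vec.span (insert a I)"
    for I a b
  \<comment> \<open>The choice depends on \<open>I\<close> alone. Since \<open>\<phi>\<close>
    preserves the intersection with \<open>\<pi>\<^sub>0\<close>, the second application of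
    \<open>\<phi>\<close> uses the same transformation, which makes \<open>\<phi>\<close> an
    involution.\<close>
  define c where "c I = (SOME p. good I (fst p) (snd p))" for I
  define \<phi> where "\<phi> \<pi> = siegel (fst (c (\<pi> \<inter> \<pi>\<^sub>0))) (snd (c (\<pi> \<inter> \<pi>\<^sub>0))) ` \<pi>" for \<pi>
  have good: "good (\<pi> \<inter> \<pi>\<^sub>0) (fst (c (\<pi> \<inter> \<pi>\<^sub>0))) (snd (c (\<pi> \<inter> \<pi>\<^sub>0)))" if "\<pi> \<in> X" for \<pi>
  proof -
    let ?I = "\<pi> \<inter> \<pi>\<^sub>0"
    have \<pi>: "\<pi> \<in> gens" "even (vec.dim ?I + d)" "\<pi> \<noteq> \<pi>\<^sub>0"
      using that by (auto simp: X_def gens_class_def)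
    have "?I \<noteq> \<pi>\<^sub>0"
      using \<pi> gensD(3)[OF \<pi>(1)] gensD(3)[OF \<pi>0] card_subset_eq[of \<pi> \<pi>\<^sub>0] by auto
    then obtain a where a: "a \<in> \<pi>\<^sub>0" "a \<notin> ?I" by blast
    have I: "vec.subspace ?I"
      using gensD(1)[OF \<pi>0] gensD(1)[OF \<pi>(1)] by (simp add: vec.subspace_inter)
    have le: "vec.dim ?I \<le> d" using vec.dim_subset[of ?I \<pi>\<^sub>0] gensD(4)[OF \<pi>0] by simp
    have "vec.dim ?I \<noteq> d"
      using card_subspace[OF I] gensD(3)[OF \<pi>0] card_subset_eq[of \<pi>\<^sub>0 ?I] \<open>?I \<noteq> \<pi>\<^sub>0\<close> by auto
    \<comment> \<open>Within the class the codimension of \<open>?I\<close> is even, so it is at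
      least 2 once nonzero. This leaves room for both \<open>a\<close> and \<open>b\<close>.\<close>
    moreover have "m + 1 < d" if "m \<le> d" "even (m + d)" "m \<noteq> d" for m
      using that by presburger
    ultimately have "vec.dim ?I + 1 < d" using le \<pi>(2) by blast
    moreover have "vec.dim (vec.span (insert a ?I)) \<le> vec.dim ?I + 1"
      by (simp add: vec.dim_insert)
    ultimately have "vec.dim (vec.span (insert a ?I)) < vec.dim \<pi>\<^sub>0" using gensD(4)[OF \<pi>0] by simp
    then have "\<not> \<pi>\<^sub>0 \<subseteq> vec.span (insert a ?I)" using vec.dim_subset leD by blast
    then obtain b where "b \<in> \<pi>\<^sub>0" "b \<notin> vec.span (insert a ?I)" by blast
    with a have "good ?I (fst (a, b)) (snd (a, b))" by (simp add: good_def)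
    then show ?thesis unfolding c_def by (rule someI)
  qed
  have "even (card X)"
  proof (rule even_card_involution[of _ \<phi>])
    fix \<pi> assume X: "\<pi> \<in> X"
    define a b where "a = fst (c (\<pi> \<inter> \<pi>\<^sub>0))" and "b = snd (c (\<pi> \<inter> \<pi>\<^sub>0))"
    have ab: "a \<in> \<pi>\<^sub>0" "b \<in> \<pi>\<^sub>0" "a \<notin> \<pi> \<inter> \<pi>\<^sub>0" "b \<notin> vec.span (insert a (\<pi> \<inter> \<pi>\<^sub>0))"
      using good[OF X] unfolding good_def a_def b_def by blast+
    have \<phi>: "\<phi> \<pi> = siegel a b ` \<pi>" by (simp add: \<phi>_def a_def b_def)
    have \<pi>: "\<pi> \<in> gens" using X by (simp add: X_def gens_class_def)
    note T = siegel[OF two \<pi>0 ab(1,2)]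
    have inj: "inj (siegel a b)" by (metis T(4) injI)
    have Int: "\<phi> \<pi> \<inter> \<pi>\<^sub>0 = \<pi> \<inter> \<pi>\<^sub>0"
    proof
      show "\<pi> \<inter> \<pi>\<^sub>0 \<subseteq> \<phi> \<pi> \<inter> \<pi>\<^sub>0"
      proof
        fix v assume "v \<in> \<pi> \<inter> \<pi>\<^sub>0"
        then show "v \<in> \<phi> \<pi> \<inter> \<pi>\<^sub>0" unfolding \<phi> using T(5)[of v] by (metis IntD1 IntD2 IntI imageI)
      qed
      show "\<phi> \<pi> \<inter> \<pi>\<^sub>0 \<subseteq> \<pi> \<inter> \<pi>\<^sub>0"
      proof
        fix w assume w: "w \<in> \<phi> \<pi> \<inter> \<pi>\<^sub>0"
        then obtain v where v: "v \<in> \<pi>" "w = siegel a b v" unfolding \<phi> by blast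
        then have "w = v" using T(4)[of v] T(5)[of w] w by simp
        then show "w \<in> \<pi> \<inter> \<pi>\<^sub>0" using v w by simp
      qed
    qed
    show "\<phi> \<pi> \<in> X"
    proof -
      have "\<phi> \<pi> \<noteq> \<pi>\<^sub>0" using Int ab(1,3) by blast
      moreover have "\<phi> \<pi> \<in> gens" unfolding \<phi> by (rule image_gens[OF \<pi> inj T(1,2,3)])
      ultimately show ?thesis using X Int by (simp add: X_def gens_class_def)
    qed
    show "\<phi> (\<phi> \<pi>) = \<pi>"
    proof -
      have "\<phi> (\<phi> \<pi>) = siegel a b ` \<phi> \<pi>" unfolding \<phi>_def[of "\<phi> \<pi>"] Int a_def b_def ..
      then show ?thesis unfolding \<phi> by (simp add: image_image T(4))
    qed
    show "\<phi> \<pi> \<noteq> \<pi>"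
    proof
      \<comment> \<open>Displacements of vectors of \<open>\<pi>\<close> then lie in
        \<open>\<pi> \<inter> \<pi>\<^sub>0\<close>. Independence of \<open>a\<close> and
        \<open>b\<close> modulo this intersection kills both coefficients, so \<open>a\<close> is
        orthogonal to \<open>\<pi>\<close> and hence in it.\<close>
      assume stable: "\<phi> \<pi> = \<pi>"
      have "polar_form Q v b = 0" "polar_form Q v a = 0" if v: "v \<in> \<pi>" for v
      proof -
        let ?u = "polar_form Q v a *s b - polar_form Q v b *s a"
        let ?S = "vec.span (insert a (\<pi> \<inter> \<pi>\<^sub>0))"
        have "siegel a b v - v \<in> \<pi>" using stable v gensD(1)[OF \<pi>] unfolding \<phi>
          by (metis imageI vec.subspace_diff)
        then have "?u \<in> \<pi>" by (simp add: siegel_def)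
        moreover have "?u \<in> \<pi>\<^sub>0" using ab gensD(1)[OF \<pi>0]
          by (simp add: vec.subspace_diff vec.subspace_scale)
        ultimately have u: "?u \<in> \<pi> \<inter> \<pi>\<^sub>0" by simp
        then have "?u + polar_form Q v b *s a \<in> ?S"
          by (intro vec.span_add vec.span_scale vec.span_base) auto
        then have "polar_form Q v a *s b \<in> ?S" by simp
        then show a0: "polar_form Q v a = 0" 
          using ab(4) by (rule subspace_scale_cancel[OF vec.subspace_span])
        have I: "vec.subspace (\<pi> \<inter> \<pi>\<^sub>0)"
          using gensD(1)[OF \<pi>] gensD(1)[OF \<pi>0] by (simp add: vec.subspace_inter)
        have "polar_form Q v b *s a \<in> \<pi> \<inter> \<pi>\<^sub>0"
          using vec.subspace_neg[OF I u] a0 by simp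
        then show "polar_form Q v b = 0" using ab(3) by (rule subspace_scale_cancel[OF I])
      qed
      then have "a \<in> \<pi>" using perp_gens[OF \<pi>] by blast
      then show False using ab by simp
    qed
  qed simp
  moreover have "\<pi>\<^sub>0 \<in> gens_class \<pi>\<^sub>0" using \<pi>0 gensD(4)[OF \<pi>0] by (simp add: gens_class_def)
  then have "card (gens_class \<pi>\<^sub>0) = Suc (card X)"
    unfolding X_def by (intro card.remove) simp_all
  ultimately show ?thesis by simp
qed

end

section \<open>Alternating matrices and the generators disjoint from a given one\<close>

lemma card_pairs_less: "card (SIGMA j:{..<d}. {..<j}) = d choose 2"
proof -
  have "(\<Sum>j<d. j) = d choose 2"
    by (induction d) (simp_all add: numeral_2_eq_2)
  then show ?thesis by simp
qed

text \<open>Only values of \<open>c\<close> at pairs with the larger index first are read, so the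
  free entries are indexed by \<open>SIGMA j:{..<d}. {..<j}\<close>.\<close>

definition alternating_matrix :: "(nat \<times> nat \<Rightarrow> 'a::comm_ring_1) \<Rightarrow> nat \<Rightarrow> nat \<Rightarrow> 'a" where
  "alternating_matrix c i j = (if i < j then c (j, i) else if j < i then - c (i, j) else 0)"

text \<open>The diagonal is 0 and the new row cancels the new column, in every
  characteristic.\<close>

lemma alternating_sum: "(\<Sum>j<n. \<Sum>i<n. alternating_matrix c i j * y i * y j) = 0"
proof (induction n)
  case (Suc n)
  have "(\<Sum>j<Suc n. \<Sum>i<Suc n. alternating_matrix c i j * y i * y j)
    = (\<Sum>j<n. \<Sum>i<n. alternating_matrix c i j * y i * y j) + (\<Sum>j<n. alternating_matrix c n j * y n * y j)
      + (\<Sum>i<n. alternating_matrix c i n * y i * y n)"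
    by (simp add: sum.distrib alternating_matrix_def[of c n n])
  also have "(\<Sum>j<n. alternating_matrix c n j * y n * y j) = - (\<Sum>i<n. alternating_matrix c i n * y i * y n)"
    unfolding sum_negf[symmetric] by (rule sum.cong) (auto simp: alternating_matrix_def)
  finally show ?case using Suc by simp
qed simp

context hyperbolic_quadric
begin

text \<open>The maps \<open>1 + A\<close>, with \<open>A\<close> an alternating map from \<open>V/\<tau>\<close> to \<open>\<tau>\<close>, are isometries that act
  freely on the generators disjoint from \<open>\<tau>\<close>. They form a group of order \<open>q ^ (d choose 2)\<close>,
  parametrised by the entries \<open>c (j, i)\<close> with \<open>i < j < d\<close> of an alternating matrix.\<close>

lemma card_disjoint_gens:
  assumes \<tau>: "\<tau> \<in> gens"
  shows "CARD('k) ^ (d choose 2) dvd card {\<pi> \<in> gens. \<pi> \<inter> \<tau> = {0}}"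
proof -
  let ?B = "polar_form Q"
  obtain E where E: "E \<subseteq> \<tau>" "vec.independent E" "card E = d"
    using vec.basis_exists[of \<tau>] gensD(4)[OF \<tau>] by metis
  obtain e where e: "bij_betw e {..<d} E"
    using ex_bij_betw_nat_finite[of E] E(3) by (auto simp: atLeast0LessThan)
  have e\<tau>: "e i \<in> \<tau>" if "i < d" for i
    using e E(1) that by (auto simp: bij_betw_def)
  have indep: "a i = b i" if "(\<Sum>i<d. a i *s e i) = (\<Sum>i<d. b i *s e i)" "i < d" for a b i
  proof -
    let ?i = "the_inv_into {..<d} e"
    have inv: "?i (e j) = j" if "j < d" for j
      using e that by (simp add: bij_betw_def the_inv_into_f_f)
    have "(\<Sum>v\<in>E. (a (?i v) - b (?i v)) *s v) = (\<Sum>i<d. (a (?i (e i)) - b (?i (e i))) *s e i)"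
      by (rule sum.reindex_bij_betw[OF e, symmetric])
    also have "\<dots> = (\<Sum>i<d. (a i - b i) *s e i)"
      by (rule sum.cong) (simp_all add: inv)
    also have "\<dots> = 0"
      using that(1) by (simp add: sum_subtractf vec.scale_left_diff_distrib)
    finally have "a (?i (e i)) - b (?i (e i)) = 0"
      using vec.independentD[OF E(2) _ order_refl, of "\<lambda>v. a (?i v) - b (?i v)" "e i"] e that(2)
      by (auto simp: bij_betw_def)
    then show ?thesis using inv[OF that(2)] by simp
  qed
  define u where "u c j = (\<Sum>i<d. alternating_matrix c i j *s e i)" for c j
  \<comment> \<open>The \<open>u c j\<close> are the columns of the matrix in the basis
    \<open>e\<close>. Both they and the values of \<open>A c\<close> lie in \<open>\<tau>\<close>,
    where the polar form vanishes, so \<open>A c\<close> kills \<open>\<tau>\<close>.\<close>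
  define A where "A c v = (\<Sum>j<d. ?B v (u c j) *s e j)" for c v
  define g where "g c v = v + A c v" for c v
  note sub = gensD(1)[OF \<tau>]
  have u\<tau>: "u c j \<in> \<tau>" for c j
    unfolding u_def by (intro vec.subspace_sum[OF sub] vec.subspace_scale[OF sub] e\<tau>) simp
  have A\<tau>: "A c v \<in> \<tau>" for c v
    unfolding A_def by (intro vec.subspace_sum[OF sub] vec.subspace_scale[OF sub] e\<tau>) simp
  have A_kills: "A c v = 0" if "v \<in> \<tau>" for c v
    unfolding A_def using polar_gens[OF \<tau> that u\<tau>] by simp
  have A_lin: "A c (v + w) = A c v + A c w" "A c (r *s v) = r *s A c v" for c v w r
    unfolding A_def
    by (simp_all add: bilinear_simps vec.scale_left_distrib sum.distrib vec.scale_sum_right)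
  have u_add: "u (\<lambda>p. c p + c' p) j = u c j + u c' j" for c c' j
    unfolding u_def sum.distrib[symmetric]
    by (rule sum.cong) (auto simp: alternating_matrix_def vec.scale_left_distrib vec.scale_left_diff_distrib)
  have A_add: "A (\<lambda>p. c p + c' p) v = A c v + A c' v" for c c' v
    unfolding A_def u_add by (simp add: bilinear_simps vec.scale_left_distrib sum.distrib)
  have B_A: "?B v (A c v) = 0" for c v
  proof -
    \<comment> \<open>This is the alternating matrix evaluated at the vector with entries
      \<open>?B v (e i)\<close>.\<close>
    have "?B v (A c v) = (\<Sum>j<d. \<Sum>i<d. alternating_matrix c i j * ?B v (e i) * ?B v (e j))"
      unfolding A_def u_def by (simp add: sum_right scale_right sum_distrib_right)
    then show ?thesis by (simp add: alternating_sum)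
  qed
  have g_lin: "g c (v + w) = g c v + g c w" "g c (r *s v) = r *s g c v" for c v w r
    unfolding g_def A_lin by (simp_all add: vec.scale_right_distrib)
  have Q_g: "Q (g c v) = Q v" for c v
    unfolding g_def Q_add B_A using gensD(2)[OF \<tau> A\<tau>] by simp
  \<comment> \<open>The composite of \<open>A c\<close> and \<open>A c'\<close> is 0, so composing
    the maps \<open>g\<close> adds their parameters.\<close>
  have g_add: "g (\<lambda>p. c p + c' p) v = g c (g c' v)" for c c' v
    unfolding g_def A_lin A_add A_kills[OF A\<tau>] by simp
  have "alternating_matrix (\<lambda>_. 0 :: 'k) i j = 0" for i j by (simp add: alternating_matrix_def)
  then have g_zero: "g (\<lambda>_. 0) v = v" for v
    unfolding g_def A_def u_def by simp
  have g_inv: "g (\<lambda>p. - c p) (g c v) = v" for c v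
    using g_add[of "\<lambda>p. - c p" c v] g_zero by simp
  have g_inj: "inj (g c)" for c by (metis g_inv injI)
  define Pairs where "Pairs = (SIGMA j:{..<d}. {..<j})"
  have g_cong: "g c = g c'" if "\<And>p. p \<in> Pairs \<Longrightarrow> c p = c' p" for c c'
  proof -
    have "alternating_matrix c i j = alternating_matrix c' i j" if "i < d" "j < d" for i j
      using \<open>\<And>p. p \<in> Pairs \<Longrightarrow> c p = c' p\<close> that by (auto simp: alternating_matrix_def Pairs_def)
    then show ?thesis unfolding g_def A_def u_def by (intro ext) simp
  qed
  define X where "X = {\<pi> \<in> gens. \<pi> \<inter> \<tau> = {0}}"
  have X_g: "g c ` \<pi> \<in> X" if "\<pi> \<in> X" for c \<pi>
  proof -
    have "g c ` \<pi> \<in> gens" using that by (intro image_gens g_inj g_lin Q_g) (simp add: X_def)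
    moreover have "g c ` \<pi> \<inter> \<tau> \<subseteq> {0}"
    proof
      fix w assume w: "w \<in> g c ` \<pi> \<inter> \<tau>"
      then obtain v where v: "v \<in> \<pi>" "w = v + A c v" by (auto simp: g_def)
      have "w - A c v \<in> \<tau>" using w A\<tau> sub by (simp add: vec.subspace_diff)
      then have "v \<in> \<pi> \<inter> \<tau>" using v by simp
      then have "v = 0" using that unfolding X_def by blast
      then show "w \<in> {0}" using v A_kills[of 0 c] vec.subspace_0[OF sub] by simp
    qed
    moreover have "0 \<in> g c ` \<pi> \<inter> \<tau>"
      using vec.subspace_0[OF sub] vec.subspace_0[OF gensD(1)[OF \<open>g c ` \<pi> \<in> gens\<close>]] by simp
    ultimately show ?thesis by (auto simp: X_def)
  qed
  \<comment> \<open>Disjointness from \<open>\<tau>\<close> forces \<open>A c\<close> and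
    \<open>A c'\<close> to agree on \<open>\<pi>\<close>. Then the differences of columns are
    orthogonal to \<open>\<pi>\<close>, so they lie in \<open>\<pi> \<inter> \<tau>\<close> and
    vanish.\<close>
  have free: "c p = c' p" if \<pi>: "\<pi> \<in> X" and eq: "g c ` \<pi> = g c' ` \<pi>" and p: "p \<in> Pairs" for c c' \<pi> p
  proof -
    have \<pi>': "\<pi> \<in> gens" "\<pi> \<inter> \<tau> = {0}" using \<pi> by (auto simp: X_def)
    have "A c v = A c' v" if v: "v \<in> \<pi>" for v
    proof -
      obtain v' where v': "v' \<in> \<pi>" "g c v = g c' v'" using eq v by blast
      then have "v - v' = A c' v' - A c v" by (simp add: g_def algebra_simps)
      moreover have "v - v' \<in> \<pi>" "A c' v' - A c v \<in> \<tau>"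
        using v v' gensD(1)[OF \<pi>'(1)] A\<tau> sub by (simp_all add: vec.subspace_diff)
      ultimately have "v - v' \<in> \<pi> \<inter> \<tau>" by simp
      then have "v = v'" using \<pi>' by simp
      then show ?thesis using v' by (simp add: g_def)
    qed
    then have "?B v (u c j) = ?B v (u c' j)" if "v \<in> \<pi>" "j < d" for v j
      using indep[of "\<lambda>j. ?B v (u c j)" "\<lambda>j. ?B v (u c' j)" j] that by (simp add: A_def)
    then have "u c j - u c' j \<in> \<pi>" if "j < d" for j
      using that by (intro perp_gens[OF \<pi>'(1)]) (simp add: bilinear_simps)
    moreover have "u c j - u c' j \<in> \<tau>" for j
      using u\<tau> sub by (simp add: vec.subspace_diff)
    ultimately have "u c j = u c' j" if "j < d" for j
      using that \<pi>'(2) by (metis IntI eq_iff_diff_eq_0 singletonD)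
    then have "alternating_matrix c i j = alternating_matrix c' i j" if "i < d" "j < d" for i j
      using indep[of "\<lambda>i. alternating_matrix c i j" "\<lambda>i. alternating_matrix c' i j" i] that by (simp add: u_def)
    moreover obtain j i where ji: "p = (j, i)" "j < d" "i < j" using p by (auto simp: Pairs_def)
    ultimately have "alternating_matrix c i j = alternating_matrix c' i j" by simp
    then show ?thesis using ji by (simp add: alternating_matrix_def)
  qed
  define r where "r = {(\<pi>, \<rho>). \<pi> \<in> X \<and> (\<exists>c. \<rho> = g c ` \<pi>)}"
  have r: "equiv X r"
  proof (rule equivI)
    show "r \<subseteq> X \<times> X" using X_g by (auto simp: r_def)
    show "refl_on X r"
      by (rule refl_onI) (auto simp: r_def g_zero intro!: exI[of _ "\<lambda>_. 0"])
    show "sym r"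
    proof (rule symI, clarsimp simp: r_def)
      fix \<pi> c assume "\<pi> \<in> X"
      then show "g c ` \<pi> \<in> X \<and> (\<exists>c'. \<pi> = g c' ` g c ` \<pi>)"
        using X_g by (auto simp: image_image g_inv intro!: exI[of _ "\<lambda>p. - c p"])
    qed
    show "trans r"
    proof (rule transI, clarsimp simp: r_def)
      fix \<pi> c c' 
      show "\<exists>c''. g c' ` g c ` \<pi> = g c'' ` \<pi>"
        by (rule exI[of _ "\<lambda>p. c' p + c p"]) (simp add: image_image g_add)
    qed
  qed
  have "CARD('k) ^ (d choose 2) dvd card X"
  proof -
    have cardO: "card Y = CARD('k) ^ (d choose 2)" if Y: "Y \<in> X // r" for Y
    proof -
      obtain \<pi> where \<pi>: "\<pi> \<in> X" "Y = r `` {\<pi>}" using Y by (rule quotientE)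
      \<comment> \<open>Since \<open>g c\<close> depends only on the values of \<open>c\<close> on
        \<open>Pairs\<close>, extensional functions parametrise each orbit, and freeness makes this
        injective.\<close>
      let ?C = "Pairs \<rightarrow>\<^sub>E (UNIV :: 'k set)"
      have "Y = (\<lambda>c. g c ` \<pi>) ` ?C"
      proof -
        have "g c ` \<pi> \<in> (\<lambda>c. g c ` \<pi>) ` ?C" for c
          using g_cong[of c "restrict c Pairs"] by (intro image_eqI[of _ _ "restrict c Pairs"]) auto
        then show ?thesis using \<pi> by (auto simp: r_def)
      qed
      moreover have "inj_on (\<lambda>c. g c ` \<pi>) ?C"
        using free[OF \<pi>(1)] by (intro inj_onI) (blast intro: PiE_ext)
      ultimately have "card Y = card ?C" by (simp add: card_image)
      also have "\<dots> = CARD('k) ^ card Pairs"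
        by (subst card_PiE) (simp_all add: Pairs_def)
      finally show ?thesis by (simp only: Pairs_def card_pairs_less)
    qed
    have "CARD('k) ^ (d choose 2) * card (X // r) = card (\<Union> (X // r))"
    proof (rule card_partition)
      show "c1 \<inter> c2 = {}" if "c1 \<in> X // r" "c2 \<in> X // r" "c1 \<noteq> c2" for c1 c2
        using quotient_disj[OF r that(1,2)] that(3) by blast
    qed (simp_all add: cardO)
    also have "\<Union> (X // r) = X" by (rule Union_quotient[OF r])
    finally have "card X = CARD('k) ^ (d choose 2) * card (X // r)" ..
    then show ?thesis by (rule dvdI)
  qed
  then show ?thesis by (simp add: X_def)
qed

text \<open>Count the disjoint pairs in \<open>gens_class \<pi>\<^sub>0 \<times> L\<close> in two ways: the generators disjoint from a
  given \<open>\<tau>\<close> lie either all in the class or all outside it.\<close>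

lemma parameter_mult_card_class:
  assumes L: "L \<subseteq> gens" and \<pi>0: "\<pi>\<^sub>0 \<in> gens"
    and m: "m > 0" "m dvd CARD('k) ^ (d choose 2)"
    and eq: "\<And>\<pi>. \<pi> \<in> gens \<Longrightarrow>
      real (card (disjoint_members L \<pi>)) = (x - (if \<pi> \<in> L then 1 else 0)) * real m"
  shows "x * real (card (gens_class \<pi>\<^sub>0)) \<in> \<int>"
proof -
  let ?G = "gens_class \<pi>\<^sub>0"
  have G: "?G \<subseteq> gens" by (auto simp: gens_class_def)
  have filter: "card {a \<in> Y. R a} = (\<Sum>a\<in>Y. if R a then 1 else 0)"
    for Y :: "('k ^ 'n) set set" and R
    using sum.inter_filter[of Y "\<lambda>_. 1::nat" R] by simp
  have swap: "(\<Sum>\<pi>\<in>?G. card (disjoint_members L \<pi>)) = (\<Sum>\<tau>\<in>L. card {\<pi> \<in> ?G. \<pi> \<inter> \<tau> = {0}})"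
    unfolding disjoint_members_def filter by (rule sum.swap)
  have "m dvd card {\<pi> \<in> ?G. \<pi> \<inter> \<tau> = {0}}" if "\<tau> \<in> L" for \<tau>
  proof -
    have \<tau>: "\<tau> \<in> gens" using L that by blast
    \<comment> \<open>The right side does not mention \<open>\<pi>\<close>: the generators disjoint
      from \<open>\<tau>\<close> are in the class all together or not at all.\<close>
    have iff: "\<pi> \<in> ?G \<longleftrightarrow> even (vec.dim (\<tau> \<inter> \<pi>\<^sub>0))" if "\<pi> \<in> gens" "\<pi> \<inter> \<tau> = {0}" for \<pi>
      using even_dim_disjoint[OF that(1) \<tau> that(2) \<pi>0] that(1)
      by (simp only: gens_class_def mem_Collect_eq even_add) blast
    show ?thesis
    proof (cases "even (vec.dim (\<tau> \<inter> \<pi>\<^sub>0))")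
      case True
      then have "{\<pi> \<in> ?G. \<pi> \<inter> \<tau> = {0}} = {\<pi> \<in> gens. \<pi> \<inter> \<tau> = {0}}"
        by (intro Collect_cong) (metis iff G subsetD)
      then show ?thesis using dvd_trans[OF m(2) card_disjoint_gens[OF \<tau>]] by (simp only:)
    next
      case False
      then have "{\<pi> \<in> ?G. \<pi> \<inter> \<tau> = {0}} = {}"
        unfolding Collect_empty_eq by (metis iff G subsetD)
      then show ?thesis by (simp only: card.empty dvd_0_right)
    qed
  qed
  then have "m dvd (\<Sum>\<pi>\<in>?G. card (disjoint_members L \<pi>))"
    unfolding swap by (rule dvd_sum)
  then obtain K where K: "(\<Sum>\<pi>\<in>?G. card (disjoint_members L \<pi>)) = m * K" by (rule dvdE)
  \<comment> \<open>The same sum evaluated by \<open>eq\<close>: every member of the class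
    contributes \<open>x * m\<close>, reduced by \<open>m\<close> if it belongs to
    \<open>L\<close>.\<close>
  have "real (m * K) = (\<Sum>\<pi>\<in>?G. x * real m - (if \<pi> \<in> L then real m else 0))"
    unfolding K[symmetric] of_nat_sum
  proof (rule sum.cong)
    fix \<pi> assume "\<pi> \<in> ?G"
    with G eq have "real (card (disjoint_members L \<pi>)) = (x - (if \<pi> \<in> L then 1 else 0)) * real m"
      by blast
    then show "real (card (disjoint_members L \<pi>)) = x * real m - (if \<pi> \<in> L then real m else 0)"
      by (simp add: left_diff_distrib)
  qed simp
  also have "\<dots> = real (card ?G) * (x * real m) - (\<Sum>\<pi>\<in>?G. if \<pi> \<in> L then real m else 0)"
    by (simp add: sum_subtractf)
  also have "(\<Sum>\<pi>\<in>?G. if \<pi> \<in> L then real m else 0) = real (card (?G \<inter> L)) * real m"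
    using sum.inter_restrict[of ?G "\<lambda>_. real m" L] by simp
  also have "real (card ?G) * (x * real m) - real (card (?G \<inter> L)) * real m
    = (x * real (card ?G) - real (card (?G \<inter> L))) * real m"
    by (simp add: algebra_simps)
  finally have "real K * real m = (x * real (card ?G) - real (card (?G \<inter> L))) * real m"
    by (simp only: of_nat_mult mult.commute[of "real m"])
  then have "x * real (card ?G) = real K + real (card (?G \<inter> L))"
    using m(1) unfolding mult_cancel_right by simp
  then show ?thesis by simp
qed

end

section \<open>Integrality of the parameter\<close>

text \<open>\<open>r ^ k\<close> and its successor are coprime; as \<open>k > 0\<close>, this passes
  to \<open>r\<close> and then to every power of \<open>r\<close>.\<close>

lemma coprime_power_Suc:
  fixes r k m :: nat
  assumes "k > 0"
  shows "coprime (r ^ k + 1) (r ^ m)"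
proof -
  have "coprime (r ^ k + 1) (r ^ k)" by (simp only: Suc_eq_plus1[symmetric] coprime_Suc_left_nat)
  then have "coprime (r ^ k + 1) r" unfolding coprime_power_right_iff using assms by simp
  then show ?thesis unfolding coprime_power_right_iff by simp
qed

lemma Nats_if_Ints_nonneg:
  fixes x :: real
  assumes "x \<in> \<int>" "x \<ge> 0"
  shows "x \<in> \<nat>"
  using assms by (simp add: Nats_altdef2)

text \<open>The zero subspace makes \<open>S\<close> nonempty, so the maximum that defines the rank
  is attained.\<close>

lemma ex_generator:
  assumes "{0} \<in> S" "polar_rank S = d"
  shows "\<exists>\<pi>. \<pi> \<in> generators d S"
proof -
  have "Max (vec.dim ` S) \<in> vec.dim ` S"
    using assms(1) by (intro Max_in) auto
  then show ?thesis using assms(2) by (auto simp: polar_rank_def generators_def proj_dim_def)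
qed

lemma zero_in_singular_subspaces:
  assumes "quadric S"
  shows "{0} \<in> S"
proof -
  obtain Q where Q: "quadratic_form Q" "S = singular_subspaces Q"
    using assms by (auto simp: quadric_def)
  have "Q (0 *s 0) = 0\<^sup>2 * Q 0" using Q(1) unfolding quadratic_form_def by blast
  then show ?thesis by (simp add: Q(2) singular_subspaces_def vec.subspace_def)
qed

lemma zero_in_isotropic_subspaces:
  assumes "sesquilinear \<sigma> f"
  shows "{0} \<in> isotropic_subspaces f"
proof -
  have "Vector_Spaces.linear (*s) (*) (\<lambda>u. f u 0)"
    using assms unfolding sesquilinear_def by blast
  then have "f (0 *s 0) 0 = 0 * f 0 0" unfolding Vector_Spaces.linear_iff by blast
  then show ?thesis by (simp add: isotropic_subspaces_def vec.subspace_def)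
qed

lemma quotient_mult_Ints:
  fixes x :: real
  assumes "x = real a / real b" "b > 0"
  shows "x * real b \<in> \<int>"
  using assms by simp

lemma parameter_power_Ints:
  fixes x :: real
  assumes "real n = (x - (if P then 1 else 0)) * real m"
  shows "x * real m \<in> \<int>"
proof -
  have "x * real m = real n + (if P then real m else 0)"
    using assms by (auto simp: algebra_simps)
  then show ?thesis by auto
qed

text \<open>Writing \<open>q = r ^ s\<close> and \<open>e = h / s\<close> turns the real powers of
  \<open>q\<close> into natural powers of \<open>r\<close>. As \<open>h > 0\<close>, each factor of
  the product is 1 plus a positive power of \<open>r\<close>, so it is coprime to the other
  multiplier.\<close>

lemma non_hyperbolic_parameter:
  fixes S L :: "('k::{field,finite} ^ 'n) set set"
  assumes CL: "cameron_liebler_set T d S L x" and ne: "\<pi> \<in> generators d S"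
    and r: "CARD('k) = r ^ s" "s > 0" and e: "type_parameter T = real h / real s" "h > 0"
  shows "x \<in> \<nat>"
proof -
  have "r > 0" using r one_less_card_field[where 'k='k] by (cases r) (simp_all add: zero_power)
  have pow: "real CARD('k) powr y = real r powr (real s * y)" for y
    using \<open>r > 0\<close> unfolding r(1) of_nat_power by (simp add: powr_realpow[symmetric] powr_powr)
  have q1: "real CARD('k) powr (type_parameter T + real i) = real (r ^ (h + s * i))" for i
  proof -
    have "real s * (type_parameter T + real i) = real (h + s * i)"
      using r(2) by (simp add: e(1) field_simps)
    then show ?thesis unfolding pow using \<open>r > 0\<close> by (simp only: powr_realpow of_nat_power of_nat_0_less_iff)
  qed
  have q2: "real CARD('k) powr (real a + type_parameter T * real b) = real (r ^ (s * a + h * b))" for a b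
  proof -
    have "real s * (real a + type_parameter T * real b) = real (s * a + h * b)"
      using r(2) by (simp add: e(1) field_simps)
    then show ?thesis unfolding pow using \<open>r > 0\<close> by (simp only: powr_realpow of_nat_power of_nat_0_less_iff)
  qed
  let ?P = "\<Prod>i<d-1. r ^ (h + s * i) + 1" and ?M = "r ^ (s * ((d - 1) choose 2) + h * (d - 1))"
  have x: "x = real (card L) / real ?P"
    and d: "real (card (disjoint_members L \<pi>)) = (x - (if \<pi> \<in> L then 1 else 0)) * real ?M"
    using CL ne unfolding cameron_liebler_set_def Let_def q1 q2 by (simp_all add: add.commute)
  have "?P > 0" by (rule prod_pos) simp
  with x have "x * real ?P \<in> \<int>" by (rule quotient_mult_Ints)
  moreover have "x * real ?M \<in> \<int>" using d by (rule parameter_power_Ints)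
  moreover have "coprime ?P ?M" using e(2) by (intro prod_coprime_left coprime_power_Suc) simp
  ultimately have "x \<in> \<int>" using Ints_mult_gcd[of x ?P ?M] by simp
  moreover have "x \<ge> 0" unfolding x by (intro divide_nonneg_nonneg of_nat_0_le_iff)
  ultimately show ?thesis by (rule Nats_if_Ints_nonneg)
qed

text \<open>The product starts at \<open>i = 1\<close>, so the factor 2 is absent and the
  coprimality argument applies directly.\<close>

lemma class_parameter:
  fixes S L :: "('k::{field,finite} ^ 'n) set set"
  assumes CL: "cameron_liebler_set_of_class d G L x" and ne: "\<pi> \<in> G"
  shows "x \<in> \<nat>"
proof -
  let ?P = "\<Prod>i\<in>{1..<d-1}. CARD('k) ^ i + 1" and ?M = "CARD('k) ^ ((d - 1) choose 2)"
  have x: "x = real (card L) / real ?P"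
    and d: "real (card (disjoint_members L \<pi>)) = (x - (if \<pi> \<in> L then 1 else 0)) * real ?M"
    using CL ne unfolding cameron_liebler_set_of_class_def Let_def by (simp_all add: add.commute)
  have "?P > 0" by (rule prod_pos) simp
  with x have "x * real ?P \<in> \<int>" by (rule quotient_mult_Ints)
  moreover have "x * real ?M \<in> \<int>" using d by (rule parameter_power_Ints)
  moreover have "coprime ?P ?M" by (intro prod_coprime_left coprime_power_Suc) simp
  ultimately have "x \<in> \<int>" using Ints_mult_gcd[of x ?P ?M] by simp
  moreover have "x \<ge> 0" unfolding x by (intro divide_nonneg_nonneg of_nat_0_le_iff)
  ultimately show ?thesis by (rule Nats_if_Ints_nonneg)
qed

lemma hyperbolic_parameter:
  fixes S L :: "('k::{field,finite} ^ 'n) set set"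
  assumes CL: "cameron_liebler_set Hyperbolic d S L x" and S: "classical_polar_space Hyperbolic d S"
  shows "x \<in> \<nat>"
proof -
  let ?q = "CARD('k)"
  obtain Q where Q: "quadratic_form Q" "nondegenerate_quadratic Q" "S = singular_subspaces Q"
    and index: "CARD('n) = 2 * d" and S': "polar_rank S = d" "quadric S"
    using S by (auto simp: classical_polar_space_def quadric_def)
  interpret hyperbolic_quadric Q d using Q index by unfold_locales
  obtain \<pi> where \<pi>: "\<pi> \<in> gens"
    using ex_generator[OF zero_in_singular_subspaces[OF S'(2)] S'(1)] Q(3) by blast
  let ?N = "(d - 1) choose 2"
  have powr: "real ?q powr real i = real (?q ^ i)" for i
    using one_less_card_field[where 'k='k] by (simp add: powr_realpow)
  have L: "L \<subseteq> gens" and x: "x = real (card L) / real (\<Prod>i<d-1. ?q ^ i + 1)"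
    and disj: "\<And>\<pi>. \<pi> \<in> gens \<Longrightarrow>
      real (card (disjoint_members L \<pi>)) = (x - (if \<pi> \<in> L then 1 else 0)) * real (?q ^ ?N)"
    using CL unfolding cameron_liebler_set_def Let_def Q(3) type_parameter.simps
      add_0 mult_zero_left add_0_right powr by (simp_all add: add.commute)
  have "x \<ge> 0" unfolding x by (intro divide_nonneg_nonneg of_nat_0_le_iff)
  have "x \<in> \<int>"
  proof (cases "d \<le> 1")
    case True
    \<comment> \<open>The product is empty, so \<open>x\<close> is the cardinality of
      \<open>L\<close>.\<close>
    then show ?thesis unfolding x by simp
  next
    case False
    let ?P = "\<Prod>i\<in>{1..<d-1}. ?q ^ i + 1"
    have "{..<d-1} = insert 0 {1..<d-1}" using False by auto
    then have P: "(\<Prod>i<d-1. ?q ^ i + 1) = 2 * ?P" by simp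
    have "2 * ?P > 0" by (simp add: prod_pos)
    with x[unfolded P] have "x * real (2 * ?P) \<in> \<int>" by (rule quotient_mult_Ints)
    moreover have "x * real (?q ^ ?N) \<in> \<int>" using disj[OF \<pi>] by (rule parameter_power_Ints)
    ultimately have "x * real (gcd (2 * ?P) (?q ^ ?N)) \<in> \<int>" by (rule Ints_mult_gcd)
    moreover have "coprime ?P (?q ^ ?N)" by (intro prod_coprime_left coprime_power_Suc) simp
    then have "gcd (2 * ?P) (?q ^ ?N) = gcd 2 (?q ^ ?N)"
      by (intro gcd_mult_left_right_cancel) (simp only: coprime_commute)
    ultimately have g: "x * real (gcd 2 (?q ^ ?N)) \<in> \<int>" by (simp only:)
    show ?thesis
    proof (cases "even ?q")
      case True
      \<comment> \<open>The gcd is 1 if \<open>?N = 0\<close> and 2 otherwise; either way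
        \<open>2 * x\<close> is an integer, to be combined with the odd size of a class.\<close>
      have "x * real (gcd 2 (?q ^ ?N)) * real (2 div gcd 2 (?q ^ ?N)) \<in> \<int>"
        by (rule Ints_mult[OF g]) simp
      then have "x * real 2 \<in> \<int>"
        unfolding mult.assoc of_nat_mult[symmetric] by (simp only: dvd_mult_div_cancel gcd_dvd1)
      moreover have "x * real (card (gens_class \<pi>)) \<in> \<int>"
      proof (rule parameter_mult_card_class[OF L \<pi> _ _ disj])
        show "?q ^ ?N dvd ?q ^ (d choose 2)"
          by (intro le_imp_power_dvd binomial_right_mono) simp
      qed simp_all
      ultimately have "x * real (gcd 2 (card (gens_class \<pi>))) \<in> \<int>" by (rule Ints_mult_gcd)
      moreover have "coprime 2 (card (gens_class \<pi>))"
        using odd_card_gens_class[OF char_2_if_even_card[OF True] \<pi>] by simp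
      ultimately show ?thesis by simp
    next
      case False
      then have "gcd 2 (?q ^ ?N) = 1" unfolding coprime_iff_gcd_eq_1[symmetric] by simp
      from g[unfolded this] show ?thesis by simp
    qed
  qed
  with \<open>x \<ge> 0\<close> show ?thesis by (simp add: Nats_if_Ints_nonneg)
qed

theorem theorem4p8:
  fixes S L :: "('k::{field,finite} ^ 'n) set set" and d :: nat and x :: real
  assumes "(\<exists>T. classical_polar_space T d S \<and> cameron_liebler_set T d S L x) \<or>
           (classical_polar_space Hyperbolic d S \<and> even d \<and>
            (\<exists>G\<in>generator_classes d S. cameron_liebler_set_of_class d G L x))"
  shows "x \<in> \<nat>"
  using assms
proof
  assume "\<exists>T. classical_polar_space T d S \<and> cameron_liebler_set T d S L x"
  then obtain T where T: "classical_polar_space T d S" and CL: "cameron_liebler_set T d S L x"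
    by blast
  have rank: "polar_rank S = d" using T by (simp add: classical_polar_space_def)
  have hermitian: "{0} \<in> S \<and> (\<exists>r. CARD('k) = r\<^sup>2)" if "hermitian_variety S"
    using that card_involutory_field zero_in_isotropic_subspaces
    unfolding hermitian_variety_def hermitian_form_def by blast
  have symplectic: "{0} \<in> S" if "symplectic_space S"
    using that zero_in_isotropic_subspaces
    unfolding symplectic_space_def alternating_form_def by blast
  have "{0} \<in> S"
    using T hermitian symplectic zero_in_singular_subspaces[of S]
    by (cases T) (simp_all add: classical_polar_space_def)
  then obtain \<pi> where "\<pi> \<in> generators d S" using ex_generator rank by blast
  \<comment> \<open>In the cases below, \<open>s\<close> is 2 for Hermitian spaces and 1 otherwise;
    \<open>h = s * e\<close> is 1, 1, 1, 3, 2 in the order of the cases.\<close>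
  note param = non_hyperbolic_parameter[OF CL this]
  show ?thesis
  proof (cases T)
    case Hyperbolic
    then show ?thesis using hyperbolic_parameter[of d S L x] T CL by simp
  next
    case Hermitian_Odd
    then obtain r where "CARD('k) = r\<^sup>2"
      using T hermitian by (auto simp: classical_polar_space_def)
    from param[OF this, of 1] show ?thesis by (simp add: Hermitian_Odd)
  next
    case Symplectic
    from param[of "CARD('k)" 1 1] show ?thesis by (simp add: Symplectic)
  next
    case Parabolic
    from param[of "CARD('k)" 1 1] show ?thesis by (simp add: Parabolic)
  next
    case Hermitian_Even
    then obtain r where "CARD('k) = r\<^sup>2"
      using T hermitian by (auto simp: classical_polar_space_def)
    from param[OF this, of 3] show ?thesis by (simp add: Hermitian_Even)
  next
    case Elliptic
    from param[of "CARD('k)" 1 2] show ?thesis by (simp add: Elliptic)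
  qed
next
  assume "classical_polar_space Hyperbolic d S \<and> even d \<and>
    (\<exists>G\<in>generator_classes d S. cameron_liebler_set_of_class d G L x)"
  then obtain G where G: "G \<in> generator_classes d S" "cameron_liebler_set_of_class d G L x"
    by blast
  then obtain \<pi> where "\<pi> \<in> generators d S" "G = same_class d S `` {\<pi>}"
    unfolding generator_classes_def by (metis quotientE)
  \<comment> \<open>A generator meets itself in projective dimension \<open>d - 1\<close>, so it
    lies in its own class, and there is a generator to count at.\<close>
  then have "\<pi> \<in> G" by (simp add: same_class_def generators_def)
  with G(2) show ?thesis by (rule class_parameter)
qed

end
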